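(* The scheme $\mathbb{C}_1$ is deductively equivalent over $\mathrm{Kw4}$ to the scheme $$\Diamond\varphi_0\to\Diamond(\varphi_0\wedge\neg\Diamond(\neg\varphi_0\wedge\Diamond\varphi_0)),$$ and the latter scheme is deductively equivalent over $\mathrm{K}$ to the scheme $\mathrm{Grz}_\Box$: $\Box(\Box(\varphi\to\Box\varphi)\to\varphi)\to\Box\varphi$.
   Context: Modal formulas are built from variables by $\top,\neg,\wedge,\Box$, with $\Diamond=\neg\Box\neg$, $\Box^*\varphi=\varphi\wedge\Box\varphi$, $\Diamond^*\varphi=\varphi\vee\Diamond\varphi$. A normal logic is a set of formulas containing all tautologies and all instances of $\Box(\varphi\to\psi)\to(\Box\varphi\to\Box\psi)$, closed under modus ponens and $\Box$-generalisation (and uniform substitution); $\mathrm{K}$ is the smallest normal logic and $\mathrm{Kw4}$ the smallest normal logic containing all instances of w4: $\Diamond\Diamond\varphi\to\Diamond^*\varphi$. Two schemes are deductively equivalent over a normal logic $L$ if the smallest normal logic containing $L$ and the first scheme contains the second, and vice versa. $\mathbb{C}_1$ is the scheme $\Box^*\neg(\varphi_0\wedge\varphi_1)\to(\Diamond\varphi_0\to\Diamond(\varphi_0\wedge\neg\Diamond(\varphi_1\wedge\Diamond\varphi_0)))$. *)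

theory Defs
  imports Main
begin

datatype 'v fm =
    Var 'v
  | Top  ("\<^bold>\<top>")
  | Neg "'v fm"  ("\<^bold>\<not>_" [70] 70)
  | And "'v fm" "'v fm"  (infixr "\<^bold>\<and>" 65)
  | Box "'v fm"  ("\<box>_" [70] 70)

abbreviation Or :: "'v fm \<Rightarrow> 'v fm \<Rightarrow> 'v fm"  (infixr "\<^bold>\<or>" 60) where
  "\<phi> \<^bold>\<or> \<psi> \<equiv> \<^bold>\<not>(\<^bold>\<not>\<phi> \<^bold>\<and> \<^bold>\<not>\<psi>)"

abbreviation Imp :: "'v fm \<Rightarrow> 'v fm \<Rightarrow> 'v fm"  (infixr "\<^bold>\<rightarrow>" 55) where
  "\<phi> \<^bold>\<rightarrow> \<psi> \<equiv> \<^bold>\<not>(\<phi> \<^bold>\<and> \<^bold>\<not>\<psi>)"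

abbreviation Dia :: "'v fm \<Rightarrow> 'v fm"  ("\<diamond>_" [70] 70) where
  "\<diamond>\<phi> \<equiv> \<^bold>\<not>\<box>\<^bold>\<not>\<phi>"

abbreviation Box_star :: "'v fm \<Rightarrow> 'v fm"  ("\<box>\<^sup>*_" [70] 70) where
  "\<box>\<^sup>*\<phi> \<equiv> \<phi> \<^bold>\<and> \<box>\<phi>"

abbreviation Dia_star :: "'v fm \<Rightarrow> 'v fm"  ("\<diamond>\<^sup>*_" [70] 70) where
  "\<diamond>\<^sup>*\<phi> \<equiv> \<phi> \<^bold>\<or> \<diamond>\<phi>"

primrec subst :: "('v \<Rightarrow> 'v fm) \<Rightarrow> 'v fm \<Rightarrow> 'v fm" where
  "subst \<sigma> (Var p) = \<sigma> p"
| "subst \<sigma> \<^bold>\<top> = \<^bold>\<top>"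
| "subst \<sigma> (\<^bold>\<not>\<phi>) = \<^bold>\<not>(subst \<sigma> \<phi>)"
| "subst \<sigma> (\<phi> \<^bold>\<and> \<psi>) = subst \<sigma> \<phi> \<^bold>\<and> subst \<sigma> \<psi>"
| "subst \<sigma> (\<box>\<phi>) = \<box>(subst \<sigma> \<phi>)"

text \<open>Propositional truth: variables and formulas beginning with a box are
  both treated as atoms, whose truth values are given by \<open>v\<close>.\<close>

primrec prop_true :: "('v fm \<Rightarrow> bool) \<Rightarrow> 'v fm \<Rightarrow> bool" where
  "prop_true v (Var p) \<longleftrightarrow> v (Var p)"
| "prop_true v \<^bold>\<top> \<longleftrightarrow> True"
| "prop_true v (\<^bold>\<not>\<phi>) \<longleftrightarrow> \<not> prop_true v \<phi>"
| "prop_true v (\<phi> \<^bold>\<and> \<psi>) \<longleftrightarrow> prop_true v \<phi> \<and> prop_true v \<psi>"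
| "prop_true v (\<box>\<phi>) \<longleftrightarrow> v (\<box>\<phi>)"

definition tautology :: "'v fm \<Rightarrow> bool" where
  "tautology \<phi> \<longleftrightarrow> (\<forall>v. prop_true v \<phi>)"

definition normal_logic :: "'v fm set \<Rightarrow> bool" where
  "normal_logic L \<longleftrightarrow>
     (\<forall>\<phi>. tautology \<phi> \<longrightarrow> \<phi> \<in> L) \<and>
     (\<forall>\<phi> \<psi>. \<box>(\<phi> \<^bold>\<rightarrow> \<psi>) \<^bold>\<rightarrow> (\<box>\<phi> \<^bold>\<rightarrow> \<box>\<psi>) \<in> L) \<and>
     (\<forall>\<phi> \<psi>. \<phi> \<in> L \<longrightarrow> (\<phi> \<^bold>\<rightarrow> \<psi>) \<in> L \<longrightarrow> \<psi> \<in> L) \<and>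
     (\<forall>\<phi>. \<phi> \<in> L \<longrightarrow> \<box>\<phi> \<in> L) \<and>
     (\<forall>\<sigma> \<phi>. \<phi> \<in> L \<longrightarrow> subst \<sigma> \<phi> \<in> L)"

definition smallest_normal_logic :: "'v fm set \<Rightarrow> 'v fm set" where
  "smallest_normal_logic S = \<Inter>{L. normal_logic L \<and> S \<subseteq> L}"

lemma normal_logic_smallest_normal_logic: "normal_logic (smallest_normal_logic S)"
  unfolding smallest_normal_logic_def normal_logic_def by blast

lemma subset_smallest_normal_logic: "S \<subseteq> smallest_normal_logic S"
  unfolding smallest_normal_logic_def by blast

lemma smallest_normal_logic_least:
  "normal_logic L \<Longrightarrow> S \<subseteq> L \<Longrightarrow> smallest_normal_logic S \<subseteq> L"
  unfolding smallest_normal_logic_def by blast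

text \<open>A scheme is represented by the set of all its instances.\<close>

definition w4 :: "'v fm set" where
  "w4 = {\<diamond>\<diamond>\<phi> \<^bold>\<rightarrow> \<diamond>\<^sup>*\<phi> | \<phi>. True}"

definition K :: "'v fm set" where
  "K = smallest_normal_logic {}"

definition Kw4 :: "'v fm set" where
  "Kw4 = smallest_normal_logic w4"

definition deductively_equivalent_over :: "'v fm set \<Rightarrow> 'v fm set \<Rightarrow> 'v fm set \<Rightarrow> bool" where
  "deductively_equivalent_over L S T \<longleftrightarrow>
     T \<subseteq> smallest_normal_logic (L \<union> S) \<and> S \<subseteq> smallest_normal_logic (L \<union> T)"

definition C1 :: "'v fm set" where
  "C1 = {\<box>\<^sup>*\<^bold>\<not>(\<phi>\<^sub>0 \<^bold>\<and> \<phi>\<^sub>1) \<^bold>\<rightarrow> (\<diamond>\<phi>\<^sub>0 \<^bold>\<rightarrow> \<diamond>(\<phi>\<^sub>0 \<^bold>\<and> \<^bold>\<not>\<diamond>(\<phi>\<^sub>1 \<^bold>\<and> \<diamond>\<phi>\<^sub>0))) | \<phi>\<^sub>0 \<phi>\<^sub>1. True}"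

definition C1_neg :: "'v fm set" where
  "C1_neg = {\<diamond>\<phi>\<^sub>0 \<^bold>\<rightarrow> \<diamond>(\<phi>\<^sub>0 \<^bold>\<and> \<^bold>\<not>\<diamond>(\<^bold>\<not>\<phi>\<^sub>0 \<^bold>\<and> \<diamond>\<phi>\<^sub>0)) | \<phi>\<^sub>0. True}"

definition Grz_Box :: "'v fm set" where
  "Grz_Box = {\<box>(\<box>(\<phi> \<^bold>\<rightarrow> \<box>\<phi>) \<^bold>\<rightarrow> \<phi>) \<^bold>\<rightarrow> \<box>\<phi> | \<phi>. True}"

end

theory Submission
  imports Defs
begin

text \<open>Contraposing \<open>Grz\<^sub>\<box>\<close> at \<open>\<not>\<phi>\<^sub>0\<close> yields the scheme \<open>C1_neg\<close>, because
  \<open>\<not>\<diamond>(\<not>\<phi>\<^sub>0 \<and> \<diamond>\<phi>\<^sub>0)\<close> is \<open>\<box>(\<not>\<phi>\<^sub>0 \<rightarrow> \<box>\<not>\<phi>\<^sub>0)\<close>. The scheme \<open>C1_neg\<close> is the case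
  \<open>\<phi>\<^sub>1 = \<not>\<phi>\<^sub>0\<close> of \<open>C1\<close>. Conversely, in \<open>Kw4\<close> the premise \<open>\<box>\<^sup>*\<not>(\<phi>\<^sub>0 \<and> \<phi>\<^sub>1)\<close> gives
  \<open>\<box>\<box>\<not>(\<phi>\<^sub>0 \<and> \<phi>\<^sub>1)\<close>, so two steps away from the root \<open>\<phi>\<^sub>1\<close> implies \<open>\<not>\<phi>\<^sub>0\<close>.\<close>

text \<open>Premises are discharged one at a time: each becomes the antecedent of an implication,
  which modus ponens removes. Boxed formulas are atoms for \<open>prop_true\<close>, so any
  reasoning under a box has to enter through \<open>As\<close>.\<close>

lemma normal_logic_taut_consequence:
  assumes "normal_logic L" "set As \<subseteq> L"
    and "\<And>v. \<forall>A\<in>set As. prop_true v A \<Longrightarrow> prop_true v B"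
  shows "B \<in> L"
  using assms(2,3)
proof (induction As arbitrary: B)
  case Nil
  then show ?case
    using assms(1) by (auto simp: normal_logic_def tautology_def)
next
  case (Cons A As)
  have "(A \<^bold>\<rightarrow> B) \<in> L"
    using Cons.prems by (intro Cons.IH) auto
  moreover have "A \<in> L"
    using Cons.prems by simp
  ultimately show ?case
    using assms(1) unfolding normal_logic_def by blast
qed

lemma normal_logic_box_mono2:
  assumes L: "normal_logic L" and "(A \<^bold>\<rightarrow> (B \<^bold>\<rightarrow> C)) \<in> L"
  shows "(\<box>A \<^bold>\<rightarrow> (\<box>B \<^bold>\<rightarrow> \<box>C)) \<in> L"
proof -
  have "\<box>(A \<^bold>\<rightarrow> (B \<^bold>\<rightarrow> C)) \<in> L"
    "(\<box>(A \<^bold>\<rightarrow> (B \<^bold>\<rightarrow> C)) \<^bold>\<rightarrow> (\<box>A \<^bold>\<rightarrow> \<box>(B \<^bold>\<rightarrow> C))) \<in> L"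
    "(\<box>(B \<^bold>\<rightarrow> C) \<^bold>\<rightarrow> (\<box>B \<^bold>\<rightarrow> \<box>C)) \<in> L"
    using assms unfolding normal_logic_def by blast+
  then show ?thesis
    by (intro normal_logic_taut_consequence[OF L, of
        "[\<box>(A \<^bold>\<rightarrow> (B \<^bold>\<rightarrow> C)), \<box>(A \<^bold>\<rightarrow> (B \<^bold>\<rightarrow> C)) \<^bold>\<rightarrow> (\<box>A \<^bold>\<rightarrow> \<box>(B \<^bold>\<rightarrow> C)),
          \<box>(B \<^bold>\<rightarrow> C) \<^bold>\<rightarrow> (\<box>B \<^bold>\<rightarrow> \<box>C)]"]) auto
qed

lemma normal_logic_box_mono:
  assumes L: "normal_logic L" and "(A \<^bold>\<rightarrow> B) \<in> L"
  shows "(\<box>A \<^bold>\<rightarrow> \<box>B) \<in> L"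
proof -
  have "\<box>(A \<^bold>\<rightarrow> B) \<in> L" "(\<box>(A \<^bold>\<rightarrow> B) \<^bold>\<rightarrow> (\<box>A \<^bold>\<rightarrow> \<box>B)) \<in> L"
    using assms unfolding normal_logic_def by blast+
  then show ?thesis
    using L unfolding normal_logic_def by blast
qed

lemma C1_neg_subset_if_C1_subset:
  fixes L :: "'v fm set"
  assumes L: "normal_logic L" and "C1 \<subseteq> L"
  shows "C1_neg \<subseteq> L"
proof
  fix \<theta> :: "'v fm"
  assume "\<theta> \<in> C1_neg"
  then obtain p where \<theta>: "\<theta> = \<diamond>p \<^bold>\<rightarrow> \<diamond>(p \<^bold>\<and> \<^bold>\<not>\<diamond>(\<^bold>\<not>p \<^bold>\<and> \<diamond>p))"
    unfolding C1_neg_def by blast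
  \<comment> \<open>The chosen instance of \<open>C1\<close> has premise
    \<open>\<box>\<^sup>*?n\<close>; its conjuncts lie in \<open>L\<close> as a tautology and by
    generalisation.\<close>
  let ?n = "\<^bold>\<not>(p \<^bold>\<and> \<^bold>\<not>p)"
  have "?n \<in> L"
    by (rule normal_logic_taut_consequence[OF L, of "[]"]) auto
  moreover from this have "\<box>?n \<in> L"
    using L unfolding normal_logic_def by blast
  moreover have "(\<box>\<^sup>*?n \<^bold>\<rightarrow> \<theta>) \<in> L"
    using assms(2) unfolding C1_def \<theta> by blast
  ultimately show "\<theta> \<in> L"
    by (intro normal_logic_taut_consequence[OF L, of "[?n, \<box>?n, \<box>\<^sup>*?n \<^bold>\<rightarrow> \<theta>]"]) auto
qed

lemma C1_subset_if_C1_neg_subset: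
  fixes L :: "'v fm set"
  assumes L: "normal_logic L" and "w4 \<subseteq> L" "C1_neg \<subseteq> L"
  shows "C1 \<subseteq> L"
proof
  fix \<theta> :: "'v fm"
  assume "\<theta> \<in> C1"
  then obtain p q where
    \<theta>: "\<theta> = \<box>\<^sup>*\<^bold>\<not>(p \<^bold>\<and> q) \<^bold>\<rightarrow> (\<diamond>p \<^bold>\<rightarrow> \<diamond>(p \<^bold>\<and> \<^bold>\<not>\<diamond>(q \<^bold>\<and> \<diamond>p)))"
    unfolding C1_def by blast
  let ?np = "\<^bold>\<not>(\<^bold>\<not>p \<^bold>\<and> \<diamond>p)" and ?nq = "\<^bold>\<not>(q \<^bold>\<and> \<diamond>p)"
  let ?w = "\<diamond>\<diamond>(p \<^bold>\<and> q) \<^bold>\<rightarrow> \<diamond>\<^sup>*(p \<^bold>\<and> q)"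
  let ?g = "\<diamond>p \<^bold>\<rightarrow> \<diamond>(p \<^bold>\<and> \<^bold>\<not>\<diamond>(\<^bold>\<not>p \<^bold>\<and> \<diamond>p))"
  let ?m = "\<box>\<^bold>\<not>(p \<^bold>\<and> q) \<^bold>\<rightarrow> (\<box>?np \<^bold>\<rightarrow> \<box>?nq)"
  \<comment> \<open>This is the boxed atom in \<open>\<diamond>\<diamond>(p \<and> q)\<close>, so
    contraposing \<open>?w\<close> yields it in exactly this form.\<close>
  let ?bw = "\<box>\<^bold>\<not>\<diamond>(p \<^bold>\<and> q)"
  let ?bq = "\<^bold>\<not>(p \<^bold>\<and> \<^bold>\<not>\<diamond>(q \<^bold>\<and> \<diamond>p))" and ?bp = "\<^bold>\<not>(p \<^bold>\<and> \<^bold>\<not>\<diamond>(\<^bold>\<not>p \<^bold>\<and> \<diamond>p))"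
  have "(\<^bold>\<not>(p \<^bold>\<and> q) \<^bold>\<rightarrow> (?np \<^bold>\<rightarrow> ?nq)) \<in> L"
    by (rule normal_logic_taut_consequence[OF L, of "[]"]) auto
  then have "?m \<in> L"
    by (rule normal_logic_box_mono2[OF L])
  then have "(\<^bold>\<not>\<diamond>(p \<^bold>\<and> q) \<^bold>\<rightarrow> (?bq \<^bold>\<rightarrow> ?bp)) \<in> L"
    by (intro normal_logic_taut_consequence[OF L, of "[?m]"]) auto
  then have "(?bw \<^bold>\<rightarrow> (\<box>?bq \<^bold>\<rightarrow> \<box>?bp)) \<in> L"
    by (rule normal_logic_box_mono2[OF L])
  moreover have "?w \<in> L" "?g \<in> L"
    using assms(2,3) unfolding w4_def C1_neg_def by blast+
  \<comment> \<open>The premise of \<open>\<theta>\<close> refutes the consequent of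
    \<open>?w\<close> and so gives \<open>?bw\<close>. If the final diamond of
    \<open>\<theta>\<close> failed, then \<open>\<box>?bq\<close> would hold, hence
    \<open>\<box>?bp\<close>, contradicting \<open>?g\<close> and
    \<open>\<diamond>p\<close>.\<close>
  ultimately show "\<theta> \<in> L"
    unfolding \<theta>
    by (intro normal_logic_taut_consequence[OF L, of
        "[?w, ?g, ?bw \<^bold>\<rightarrow> (\<box>?bq \<^bold>\<rightarrow> \<box>?bp)]"]) auto
qed

text \<open>Contraposing \<open>C1_neg\<close> at \<open>\<not>p\<close> leaves
  \<open>\<not>\<not>p\<close> in place of \<open>p\<close> beneath boxes. Monotonicity of the box
  removes these double negations from the inside out.\<close>

lemma Grz_Box_subset_if_C1_neg_subset:
  fixes L :: "'v fm set"
  assumes L: "normal_logic L" and "C1_neg \<subseteq> L"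
  shows "Grz_Box \<subseteq> L"
proof
  fix \<theta> :: "'v fm"
  assume "\<theta> \<in> Grz_Box"
  then obtain p where \<theta>: "\<theta> = \<box>(\<box>(p \<^bold>\<rightarrow> \<box>p) \<^bold>\<rightarrow> p) \<^bold>\<rightarrow> \<box>p"
    unfolding Grz_Box_def by blast
  let ?d = "\<^bold>\<not>\<^bold>\<not>p"
  let ?b = "\<box>?d \<^bold>\<rightarrow> \<box>p"
  let ?c = "\<box>\<^bold>\<not>(?d \<^bold>\<and> \<^bold>\<not>\<box>?d) \<^bold>\<rightarrow> \<box>(p \<^bold>\<rightarrow> \<box>p)"
  let ?e = "\<box>(p \<^bold>\<rightarrow> \<box>p) \<^bold>\<rightarrow> p"
  \<comment> \<open>\<open>\<box>?f\<close> is, up to double negation, the negated consequent of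
    \<open>?g\<close>.\<close>
  let ?f = "\<^bold>\<not>(\<^bold>\<not>p \<^bold>\<and> \<^bold>\<not>\<diamond>(?d \<^bold>\<and> \<^bold>\<not>\<box>?d))"
  let ?g = "\<diamond>\<^bold>\<not>p \<^bold>\<rightarrow> \<diamond>(\<^bold>\<not>p \<^bold>\<and> \<^bold>\<not>\<diamond>(\<^bold>\<not>\<^bold>\<not>p \<^bold>\<and> \<diamond>\<^bold>\<not>p))"
  have b: "?b \<in> L"
    by (intro normal_logic_box_mono[OF L] normal_logic_taut_consequence[OF L, of "[]"]) auto
  then have "?c \<in> L"
    by (intro normal_logic_box_mono[OF L] normal_logic_taut_consequence[OF L, of "[?b]"]) auto
  then have "(\<box>?e \<^bold>\<rightarrow> \<box>?f) \<in> L"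
    by (intro normal_logic_box_mono[OF L] normal_logic_taut_consequence[OF L, of "[?c]"]) auto
  moreover have "?g \<in> L"
    using assms(2) unfolding C1_neg_def by blast
  ultimately show "\<theta> \<in> L"
    using b unfolding \<theta>
    by (intro normal_logic_taut_consequence[OF L, of "[?b, \<box>?e \<^bold>\<rightarrow> \<box>?f, ?g]"]) auto
qed

lemma C1_neg_subset_if_Grz_Box_subset:
  fixes L :: "'v fm set"
  assumes L: "normal_logic L" and "Grz_Box \<subseteq> L"
  shows "C1_neg \<subseteq> L"
proof
  fix \<theta> :: "'v fm"
  assume "\<theta> \<in> C1_neg"
  then obtain p where \<theta>: "\<theta> = \<diamond>p \<^bold>\<rightarrow> \<diamond>(p \<^bold>\<and> \<^bold>\<not>\<diamond>(\<^bold>\<not>p \<^bold>\<and> \<diamond>p))"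
    unfolding C1_neg_def by blast
  let ?e = "\<box>(\<^bold>\<not>p \<^bold>\<rightarrow> \<box>\<^bold>\<not>p) \<^bold>\<rightarrow> \<^bold>\<not>p"
  let ?f = "\<^bold>\<not>(p \<^bold>\<and> \<^bold>\<not>\<diamond>(\<^bold>\<not>p \<^bold>\<and> \<diamond>p))"
  \<comment> \<open>In this direction \<open>?e\<close> and \<open>?f\<close> contain literally the
    same boxed atom, since \<open>\<diamond>p\<close> unfolds to \<open>\<not>\<box>\<not>p\<close>;
    hence \<open>?f \<rightarrow> ?e\<close> is already a tautology.\<close>
  have "(\<box>?f \<^bold>\<rightarrow> \<box>?e) \<in> L"
    by (intro normal_logic_box_mono[OF L] normal_logic_taut_consequence[OF L, of "[]"]) auto
  moreover have "(\<box>?e \<^bold>\<rightarrow> \<box>\<^bold>\<not>p) \<in> L"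
    using assms(2) unfolding Grz_Box_def by blast
  ultimately show "\<theta> \<in> L"
    unfolding \<theta>
    by (intro normal_logic_taut_consequence[OF L, of "[\<box>?f \<^bold>\<rightarrow> \<box>?e, \<box>?e \<^bold>\<rightarrow> \<box>\<^bold>\<not>p]"]) auto
qed

theorem theorem5p1:
  shows "deductively_equivalent_over Kw4 C1 (C1_neg :: 'v fm set) \<and>
    deductively_equivalent_over K (C1_neg :: 'v fm set) Grz_Box"
proof -
  have base: "S \<subseteq> smallest_normal_logic (L \<union> S)" "L \<subseteq> smallest_normal_logic (L \<union> S)"
    for L S :: "'v fm set"
    using subset_smallest_normal_logic[of "L \<union> S"] by auto
  \<comment> \<open>\<open>C1_subset_if_C1_neg_subset\<close> asks for \<open>w4\<close> itself,
    which is contained in \<open>Kw4\<close> as its generating set.\<close>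
  have "w4 \<subseteq> smallest_normal_logic (Kw4 \<union> C1_neg :: 'v fm set)"
    using subset_smallest_normal_logic[of w4] base(2)[of Kw4 C1_neg] unfolding Kw4_def by blast
  then show ?thesis
    unfolding deductively_equivalent_over_def
    using C1_neg_subset_if_C1_subset[OF normal_logic_smallest_normal_logic base(1)]
      C1_subset_if_C1_neg_subset[OF normal_logic_smallest_normal_logic _ base(1)]
      Grz_Box_subset_if_C1_neg_subset[OF normal_logic_smallest_normal_logic base(1)]
      C1_neg_subset_if_Grz_Box_subset[OF normal_logic_smallest_normal_logic base(1)]
    by blast
qed

end
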